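(* Let $l>0$. There is a constant $C$, independent of $\Delta x$ and of $u$, such that for every odd $N$, with $\Delta x=l/N$ and $x_n=n\Delta x$, and every sufficiently smooth ($C^3$) $l$-periodic function $u:\mathbb R\to\mathbb R$, with $\boldsymbol u=\{u(x_n)\}_{n\in\mathbb Z}$, $$\|H_{\Delta x}\boldsymbol u-Hu\|_\infty\le C(\Delta x)^2\|u\|_{C^3},$$ where $Hu$ on the left-hand side abbreviates $[Hu(x_0),Hu(x_1),\dots,Hu(x_{N-1})]^\top$.
   Context: The periodic Hilbert transform is $Hu(x)=\frac1l\,\mathrm{P.V.}\int_0^l\cot\left(\frac{\pi}{l}y\right)u(x-y)\,\mathrm dy$. For odd $N$ and $N$-periodic sequences $\boldsymbol u=\{u_n\}_{n\in\mathbb Z}$, the discrete Hilbert transform is $$(H_{\Delta x}\boldsymbol u)_n=\sum_{j=0}^{N-1}d_{n-j}u_j,\qquad d_n=\begin{cases}\frac1N\cot\left(\frac{\pi n}{2N}\right),&\text{if } n \text{ is odd},\\ -\frac1N\tan\left(\frac{\pi n}{2N}\right),&\text{if } n\text{ is even}.\end{cases}$$ Norms: $\|\boldsymbol u\|_\infty=\max_n|u_n|$ and $\|u\|_{C^3}=\max_x|u(x)|+\max_x|u'(x)|+\max_x|u''(x)|+\max_x|u'''(x)|$. *)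

theory Defs
  imports "HOL-Analysis.Analysis"
begin

text \<open>
  The singularities of the kernel at \<open>y = 0\<close> and \<open>y = l\<close> are the same point of the circle of
  length \<open>l\<close>, so the principal value removes a symmetric neighbourhood of that point.
\<close>

definition periodic_hilbert :: "real \<Rightarrow> (real \<Rightarrow> real) \<Rightarrow> real \<Rightarrow> real" where
  "periodic_hilbert l u x =
     1 / l * Lim (at_right 0)
       (\<lambda>\<epsilon>. integral {\<epsilon>..l - \<epsilon>} (\<lambda>y. cot (pi / l * y) * u (x - y)))"

definition hilbert_kernel :: "nat \<Rightarrow> int \<Rightarrow> real" where
  "hilbert_kernel N n =
     (if odd n then 1 / real N * cot (pi * of_int n / (2 * real N))
      else - (1 / real N * tan (pi * of_int n / (2 * real N))))"

definition discrete_hilbert :: "nat \<Rightarrow> (int \<Rightarrow> real) \<Rightarrow> int \<Rightarrow> real" where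
  "discrete_hilbert N v n = (\<Sum>j = 0..<int N. hilbert_kernel N (n - j) * v j)"

definition max_norm :: "nat \<Rightarrow> (int \<Rightarrow> real) \<Rightarrow> real" where
  "max_norm N v = Max ((\<lambda>n. \<bar>v n\<bar>) ` {0..<int N})"

definition C_diff :: "nat \<Rightarrow> (real \<Rightarrow> real) \<Rightarrow> bool" where
  "C_diff k u \<longleftrightarrow>
     (\<forall>i<k. \<forall>x. (deriv ^^ i) u field_differentiable (at x)) \<and>
     continuous_on UNIV ((deriv ^^ k) u)"

text \<open>
  For periodic functions of class \<open>C\<^sup>3\<close> each supremum is a maximum.
\<close>

definition C3_norm :: "(real \<Rightarrow> real) \<Rightarrow> real" where
  "C3_norm u = (\<Sum>i\<le>3. SUP x. \<bar>(deriv ^^ i) u x\<bar>)"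

end

theory Submission
  imports Defs
begin

text \<open>
  For odd \<open>N\<close> the kernel \<open>d\<close> is \<open>N\<close>-periodic, and every residue class modulo \<open>N\<close> has exactly one odd
  representative \<open>m\<close> with \<open>-N < m \<le> N\<close>. Summing over these representatives uses the cotangent branch
  only, so the discrete transform at \<open>x = x\<^sub>n\<close> equals
  \<open>1/N \<Sum>\<^bsub>m odd\<^esub> cot (\<pi> m / (2 N)) u (x - m \<Delta>x)\<close>.
  The identity \<open>2 cot (2 t) = cot t - tan t\<close> and the period \<open>l\<close> turn the principal value likewise into
  an integral over the doubled interval \<open>[-l, l]\<close> with the kernel \<open>cot (a y)\<close>, \<open>a = \<pi> / (2 l)\<close>. Folding
  both at \<open>y = 0\<close> produces the same function
  \<open>F y = cot (a y) (u (x - y) - u (x + y))\<close> on \<open>(0, l]\<close>: the continuous transform is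
  \<open>1/(2 l) \<integral>\<^sub>0\<^sup>l F\<close>, and the discrete one is the midpoint rule for this integral with the panels
  \<open>[2 i \<Delta>x, 2 (i + 1) \<Delta>x]\<close>. Because \<open>N\<close> is odd, a half panel next to \<open>l\<close> is left over; it costs no
  accuracy since \<open>F\<close> and \<open>F'\<close> vanish at \<open>l\<close>. Hence the transforms differ by
  \<open>O(\<Delta>x\<^sup>2 sup |F''|)\<close> (lemma \<open>midpoint_rule_error\<close>).

  What remains is a bound on \<open>F''\<close> up to the singularity of the cotangent. With
  \<open>h y = u (x - y) - u (x + y)\<close>, which vanishes at \<open>0\<close>, write \<open>F y = (y cot (a y)) (h y / y)\<close>. The first
  factor is smooth on \<open>[0, l]\<close>, and the first two derivatives of the divided difference \<open>h y / y\<close> are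
  bounded by suprema of \<open>h''\<close> and \<open>h'''\<close>; this is where three derivatives of \<open>u\<close> enter
  (lemma \<open>folded_integrand_derivatives\<close>).
\<close>

section \<open>The desingularised cotangent and divided differences\<close>

text \<open>
  Integrating a bound on the derivative. The weaker constant \<open>c\<close> in place of \<open>c / (n + 1)\<close> keeps this a
  single application of the mean value inequality, and constants do not matter below. It converts a
  zero of known order at \<open>0\<close> into a bound that survives division by the matching power.
\<close>

lemma power_growth_bound:
  fixes \<phi> \<phi>' :: "real \<Rightarrow> real"
  assumes "\<phi> 0 = 0" and "y \<ge> 0" and "c \<ge> 0"
    and deriv: "\<And>t. 0 \<le> t \<Longrightarrow> t \<le> y \<Longrightarrow> (\<phi> has_real_derivative \<phi>' t) (at t)"
    and bound: "\<And>t. 0 \<le> t \<Longrightarrow> t \<le> y \<Longrightarrow> \<bar>\<phi>' t\<bar> \<le> c * t ^ n"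
  shows "\<bar>\<phi> y\<bar> \<le> c * y ^ Suc n"
proof -
  have "norm (\<phi> y - \<phi> 0) \<le> (c * y ^ n) * norm (y - 0)"
  proof (rule field_differentiable_bound[where S = "{0..y}" and f' = \<phi>'])
    show "(\<phi> has_field_derivative \<phi>' t) (at t within {0..y})" if "t \<in> {0..y}" for t
      using deriv that by (auto intro: has_field_derivative_at_within)
    show "norm (\<phi>' t) \<le> c * y ^ n" if "t \<in> {0..y}" for t
    proof -
      have "\<bar>\<phi>' t\<bar> \<le> c * t ^ n" using bound that by auto
      also have "\<dots> \<le> c * y ^ n"
        using that \<open>c \<ge> 0\<close> by (intro mult_left_mono power_mono) auto
      finally show ?thesis by simp
    qed
  qed (use \<open>y \<ge> 0\<close> in auto)
  then show ?thesis using \<open>\<phi> 0 = 0\<close> \<open>y \<ge> 0\<close> by (simp add: mult_ac)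
qed

lemma half_le_sin:
  fixes t :: real
  assumes "0 \<le> t" and "t \<le> pi / 2"
  shows "t / 2 \<le> sin t"
proof -
  have "\<bar>sin t - t\<bar> \<le> t ^ 3 / 6"
    using Maclaurin_sin_bound[of t 3] \<open>0 \<le> t\<close>
    by (simp add: numeral_3_eq_3 sin_coeff_def fact_numeral)
  moreover have "t ^ 3 / 6 \<le> t / 2"
  proof -
    have "t \<le> 17 / 10" using assms pi_approx by simp
    then have "t\<^sup>2 \<le> (17/10)\<^sup>2" using \<open>0 \<le> t\<close> by (intro power_mono) auto
    then have "t * t\<^sup>2 \<le> t * 3"
      using \<open>0 \<le> t\<close> by (intro mult_left_mono) (auto simp: power2_eq_square)
    then show ?thesis by (simp add: power3_eq_cube power2_eq_square)
  qed
  ultimately show ?thesis by linarith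
qed

text \<open>
  The factor of the integrand that absorbs the pole of the cotangent, with the closed forms of its first
  two derivatives. Their denominators \<open>sin\<^sup>2\<close> and \<open>sin\<^sup>3\<close> are compensated by numerators that vanish to
  third order at \<open>0\<close>.
\<close>

definition xcot :: "real \<Rightarrow> real" where
  "xcot t = t * cot t"

definition xcot1 :: "real \<Rightarrow> real" where
  "xcot1 t = (sin t * cos t - t) / sin t ^ 2"

definition xcot2 :: "real \<Rightarrow> real" where
  "xcot2 t = 2 * (t * cos t - sin t) / sin t ^ 3"

lemma has_derivative_xcot:
  assumes "sin t \<noteq> 0"
  shows "(xcot has_real_derivative xcot1 t) (at t)"
proof -
  have "((\<lambda>t. t * (cos t / sin t)) has_real_derivative
      1 * (cos t / sin t) + (- sin t * sin t - cos t * cos t) / (sin t * sin t) * t) (at t)"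
    by (rule derivative_eq_intros refl | use assms in simp)+
  also have "- sin t * sin t - cos t * cos t = - 1"
    using sin_cos_squared_add[of t] by (simp add: power2_eq_square)
  also have "1 * (cos t / sin t) + - 1 / (sin t * sin t) * t = xcot1 t"
    using assms by (simp add: xcot1_def field_simps power2_eq_square)
  finally show ?thesis by (simp add: xcot_def[abs_def] cot_def)
qed

lemma has_derivative_xcot1:
  assumes "sin t \<noteq> 0"
  shows "(xcot1 has_real_derivative xcot2 t) (at t)"
proof -
  let ?s = "sin t" and ?c = "cos t"
  have "((\<lambda>t. (sin t * cos t - t) / sin t ^ 2) has_real_derivative
      ((?c * ?c + - ?s * ?s - 1) * ?s ^ 2 - (?s * ?c - t) * (2 * ?c * ?s)) / (?s ^ 2 * ?s ^ 2)) (at t)"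
    by (rule derivative_eq_intros refl | use assms in simp)+
  also have "(?c * ?c + - ?s * ?s - 1) * ?s ^ 2 - (?s * ?c - t) * (2 * ?c * ?s)
      = ?s * (2 * (t * ?c - ?s))"
  proof -
    have "?c * ?c = 1 - ?s * ?s"
      using sin_cos_squared_add[of t] by (simp add: power2_eq_square)
    then show ?thesis by algebra
  qed
  also have "?s * (2 * (t * ?c - ?s)) / (?s ^ 2 * ?s ^ 2) = xcot2 t"
    using assms by (simp add: xcot2_def field_simps power2_eq_square power3_eq_cube)
  finally show ?thesis by (simp add: xcot1_def[abs_def])
qed

text \<open>
  Both numerators have elementary derivatives, \<open>2 sin\<^sup>2 t\<close> and \<open>t sin t\<close> up to sign, so that they
  are \<open>O(t\<^sup>3)\<close>, while \<open>sin t \<ge> t / 2\<close> bounds the denominators from below.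
\<close>

lemma xcot_bounds:
  assumes "0 < t" and "t \<le> pi / 2"
  shows "\<bar>xcot t\<bar> \<le> 2" and "\<bar>xcot1 t\<bar> \<le> 16" and "\<bar>xcot2 t\<bar> \<le> 16"
proof -
  have s: "0 < t / 2" "t / 2 \<le> sin t" using half_le_sin assms by auto
  then have pos: "0 < sin t" by linarith
  have "\<bar>xcot t\<bar> \<le> t / sin t"
    using pos assms abs_cos_le_one[of t] by (simp add: xcot_def cot_def abs_mult field_simps)
  also have "\<dots> \<le> 2" using pos s by (simp add: field_simps)
  finally show "\<bar>xcot t\<bar> \<le> 2" .
  have "\<bar>t - sin t * cos t\<bar> \<le> 2 * t ^ Suc 2"
  proof (rule power_growth_bound[where \<phi>' = "\<lambda>t. 2 * sin t ^ 2"])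
    fix r :: real assume "0 \<le> r"
    have "((\<lambda>t. t - sin t * cos t) has_real_derivative 1 - (cos r * cos r + - sin r * sin r)) (at r)"
      by (rule derivative_eq_intros refl | simp)+
    also have "1 - (cos r * cos r + - sin r * sin r) = 2 * sin r ^ 2"
      using sin_cos_squared_add[of r] by (simp add: power2_eq_square)
    finally show "((\<lambda>t. t - sin t * cos t) has_real_derivative 2 * sin r ^ 2) (at r)" .
    show "\<bar>2 * sin r ^ 2\<bar> \<le> 2 * r ^ 2"
      using abs_sin_x_le_abs_x[of r] by (simp add: abs_le_square_iff)
  qed (use assms in auto)
  then have *: "\<bar>sin t * cos t - t\<bar> \<le> 2 * t ^ 3" by (simp add: abs_minus_commute numeral_3_eq_3)
  have "\<bar>xcot1 t\<bar> = \<bar>sin t * cos t - t\<bar> / sin t ^ 2" by (simp add: xcot1_def)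
  also have "\<dots> \<le> 2 * t ^ 3 / (t / 2) ^ 2"
    using * s by (intro frac_le power_mono) auto
  also have "\<dots> = 8 * t" using assms by (simp add: field_simps power2_eq_square power3_eq_cube)
  also have "\<dots> \<le> 16" using assms pi_approx by simp
  finally show "\<bar>xcot1 t\<bar> \<le> 16" .
  have "\<bar>sin t - t * cos t\<bar> \<le> 1 * t ^ Suc 2"
  proof (rule power_growth_bound[where \<phi>' = "\<lambda>t. t * sin t"])
    fix r :: real assume "0 \<le> r"
    show "((\<lambda>t. sin t - t * cos t) has_real_derivative r * sin r) (at r)"
      by (rule derivative_eq_intros refl | simp)+
    show "\<bar>r * sin r\<bar> \<le> 1 * r ^ 2"
      using abs_sin_x_le_abs_x[of r] \<open>0 \<le> r\<close>
      by (simp add: abs_mult power2_eq_square mult_left_mono)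
  qed (use assms in auto)
  then have *: "\<bar>t * cos t - sin t\<bar> \<le> t ^ 3" by (simp add: abs_minus_commute numeral_3_eq_3)
  have "\<bar>xcot2 t\<bar> = 2 * \<bar>t * cos t - sin t\<bar> / sin t ^ 3"
    using pos by (simp add: xcot2_def abs_mult del: right_diff_distrib_numeral)
  also have "\<dots> \<le> 2 * t ^ 3 / (t / 2) ^ 3"
    using * s by (intro frac_le power_mono) auto
  also have "\<dots> = 16" using assms by (simp add: field_simps power3_eq_cube)
  finally show "\<bar>xcot2 t\<bar> \<le> 16" .
qed

text \<open>
  The three fractions are \<open>h y / y\<close> and its first and second derivative. Their numerators vanish at \<open>0\<close>
  and telescope under differentiation: the derivatives are \<open>h'\<close>, \<open>t h''\<close> and \<open>t\<^sup>2 h'''\<close>. The orders of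
  vanishing are therefore exactly those of the denominators.
\<close>

lemma divided_difference_bounds:
  fixes h h1 h2 h3 :: "real \<Rightarrow> real"
  assumes "h 0 = 0" and "y > 0" and "B \<ge> 0"
    and d1: "\<And>t. (h has_real_derivative h1 t) (at t)"
    and d2: "\<And>t. (h1 has_real_derivative h2 t) (at t)"
    and d3: "\<And>t. (h2 has_real_derivative h3 t) (at t)"
    and b: "\<And>t. \<bar>h1 t\<bar> \<le> B" "\<And>t. \<bar>h2 t\<bar> \<le> B" "\<And>t. \<bar>h3 t\<bar> \<le> B"
  shows "\<bar>h y / y\<bar> \<le> B"
    and "\<bar>(y * h1 y - h y) / y ^ 2\<bar> \<le> B"
    and "\<bar>(y\<^sup>2 * h2 y - 2 * y * h1 y + 2 * h y) / y ^ 3\<bar> \<le> B"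
proof -
  have "\<bar>h y\<bar> \<le> B * y ^ Suc 0"
    by (rule power_growth_bound[where \<phi>' = h1]) (use assms in auto)
  then show "\<bar>h y / y\<bar> \<le> B" using \<open>y > 0\<close> by (simp add: field_simps)
  have "\<bar>y * h1 y - h y\<bar> \<le> B * y ^ Suc 1"
  proof (rule power_growth_bound[where \<phi>' = "\<lambda>t. t * h2 t"])
    show "((\<lambda>t. t * h1 t - h t) has_real_derivative t * h2 t) (at t)" for t
      by (rule derivative_eq_intros d1 d2 refl | simp)+
    show "\<bar>t * h2 t\<bar> \<le> B * t ^ 1" if "0 \<le> t" for t
      using that b(2)[of t] by (simp add: abs_mult mult.commute[of t] mult_right_mono)
  qed (use assms in auto)
  then show "\<bar>(y * h1 y - h y) / y ^ 2\<bar> \<le> B"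
    using \<open>y > 0\<close> by (simp add: divide_simps power2_eq_square)
  have "\<bar>y\<^sup>2 * h2 y - 2 * y * h1 y + 2 * h y\<bar> \<le> B * y ^ Suc 2"
  proof (rule power_growth_bound[where \<phi>' = "\<lambda>t. t\<^sup>2 * h3 t"])
    show "((\<lambda>t. t\<^sup>2 * h2 t - 2 * t * h1 t + 2 * h t) has_real_derivative t\<^sup>2 * h3 t) (at t)" for t
      by (rule derivative_eq_intros d1 d2 d3 refl | simp add: algebra_simps)+
    show "\<bar>t\<^sup>2 * h3 t\<bar> \<le> B * t\<^sup>2" for t
      using b(3)[of t] by (simp add: abs_mult mult.commute[of "t\<^sup>2"] mult_right_mono)
  qed (use assms in auto)
  then show "\<bar>(y\<^sup>2 * h2 y - 2 * y * h1 y + 2 * h y) / y ^ 3\<bar> \<le> B"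
    using \<open>y > 0\<close> by (simp add: divide_simps power2_eq_square power3_eq_cube)
qed

lemma divided_difference_derivatives:
  fixes h h1 h2 :: "real \<Rightarrow> real"
  assumes "y \<noteq> 0"
    and d1: "(h has_real_derivative h1 y) (at y)"
    and d2: "(h1 has_real_derivative h2 y) (at y)"
  shows "((\<lambda>t. h t / t) has_real_derivative (y * h1 y - h y) / y ^ 2) (at y)"
    and "((\<lambda>t. (t * h1 t - h t) / t ^ 2) has_real_derivative
          (y\<^sup>2 * h2 y - 2 * y * h1 y + 2 * h y) / y ^ 3) (at y)"
proof -
  show "((\<lambda>t. h t / t) has_real_derivative (y * h1 y - h y) / y ^ 2) (at y)"
    by (rule derivative_eq_intros d1 refl
        | use assms(1) in \<open>simp add: power2_eq_square mult.commute\<close>)+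
  have "((\<lambda>t. (t * h1 t - h t) / t ^ 2) has_real_derivative
      ((1 * h1 y + h2 y * y - h1 y) * y\<^sup>2 - (y * h1 y - h y) * (2 * y)) / (y\<^sup>2 * y\<^sup>2)) (at y)"
    by (rule derivative_eq_intros d1 d2 refl | use assms(1) in simp)+
  also have "((1 * h1 y + h2 y * y - h1 y) * y\<^sup>2 - (y * h1 y - h y) * (2 * y)) / (y\<^sup>2 * y\<^sup>2)
      = (y\<^sup>2 * h2 y - 2 * y * h1 y + 2 * h y) / y ^ 3"
    using assms(1) by (simp add: divide_simps) algebra
  finally show "((\<lambda>t. (t * h1 t - h t) / t ^ 2) has_real_derivative
      (y\<^sup>2 * h2 y - 2 * y * h1 y + 2 * h y) / y ^ 3) (at y)" .
qed

section \<open>The midpoint rule on a half-open interval\<close>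

text \<open>
  Taylor's theorem on the half-open interval, where \<open>F''\<close> is bounded, then integration, for which
  the singular point \<open>0\<close> is a null set. The expansion point \<open>c\<close> is free
  because it is used both at the midpoint of a panel and at the right end of the last half panel.
\<close>

lemma integral_tangent_error:
  fixes F F1 F2 :: "real \<Rightarrow> real"
  assumes F: "\<And>y. y \<in> {0<..l} \<Longrightarrow> (F has_real_derivative F1 y) (at y)"
    and F1: "\<And>y. y \<in> {0<..l} \<Longrightarrow> (F1 has_real_derivative F2 y) (at y)"
    and F2: "\<And>y. y \<in> {0<..l} \<Longrightarrow> \<bar>F2 y\<bar> \<le> M"
    and int: "F integrable_on {0..l}"
    and ab: "0 \<le> a" "a \<le> b" "b \<le> l" and c: "c \<in> {0<..l}"
    and near: "a \<ge> c - \<delta>" "b \<le> c + \<delta>"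
  shows "\<bar>integral {a..b} F - ((b - a) * F c + F1 c * (((b - c)\<^sup>2 - (a - c)\<^sup>2) / 2))\<bar>
    \<le> M * \<delta>\<^sup>2 * (b - a)"
proof -
  have "0 \<le> M" using F2[OF c] by linarith
  have taylor: "\<bar>F y - (F c + F1 c * (y - c))\<bar> \<le> M * \<delta>\<^sup>2"
    if y: "y \<in> {0<..l}" "\<bar>y - c\<bar> \<le> \<delta>" for y
  proof -
    \<comment> \<open>Taylor's theorem expects a single sequence of successive derivatives.\<close>
    define D where "D i = (if i = 0 then F else if i = 1 then F1 else F2)" for i :: nat
    have "norm (D 0 y - (\<Sum>i\<le>1. D i c * (y - c) ^ i / fact i)) \<le> M * norm (y - c) ^ Suc 1 / fact 1"
    proof (rule field_Taylor[of "{0<..l}"])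
      show "(D i has_field_derivative D (Suc i) x) (at x within {0<..l})"
        if "x \<in> {0<..l}" "i \<le> 1" for i x
        using that F F1 by (cases i) (auto simp: D_def intro: has_field_derivative_at_within)
      show "norm (D (Suc 1) x) \<le> M" if "x \<in> {0<..l}" for x
        using F2[OF that] by (simp add: D_def)
    qed (use y c in auto)
    then have "\<bar>F y - (F c + F1 c * (y - c))\<bar> \<le> M * (y - c)\<^sup>2"
      by (simp add: D_def numeral_2_eq_2)
    also have "\<dots> \<le> M * \<delta>\<^sup>2"
      using y \<open>0 \<le> M\<close> by (intro mult_left_mono) (auto simp flip: abs_le_square_iff)
    finally show ?thesis .
  qed
  have "F integrable_on {a..b}"
    using int by (rule integrable_subinterval_real) (use ab in auto)
  then have "(F has_integral integral {a..b} F) {a..b}" by (rule integrable_integral)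
  moreover have "((\<lambda>y. F c + F1 c * (y - c)) has_integral
      ((b - a) * F c + F1 c * (((b - c)\<^sup>2 - (a - c)\<^sup>2) / 2))) {a..b}"
  proof -
    have "((\<lambda>y. F c + F1 c * (y - c)) has_integral
        ((b * F c + F1 c * ((b - c)\<^sup>2 / 2)) - (a * F c + F1 c * ((a - c)\<^sup>2 / 2)))) {a..b}"
    proof (rule fundamental_theorem_of_calculus[OF ab(2)])
      fix y
      have "((\<lambda>y. y * F c + F1 c * ((y - c)\<^sup>2 / 2)) has_real_derivative F c + F1 c * (y - c))
          (at y within {a..b})"
        by (rule derivative_eq_intros refl | simp)+
      then show "((\<lambda>y. y * F c + F1 c * ((y - c)\<^sup>2 / 2)) has_vector_derivative F c + F1 c * (y - c))
          (at y within {a..b})"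
        by (simp add: has_real_derivative_iff_has_vector_derivative)
    qed
    then show ?thesis by (simp add: algebra_simps diff_divide_distrib)
  qed
  ultimately have "((\<lambda>y. F y - (F c + F1 c * (y - c))) has_integral
      integral {a..b} F - ((b - a) * F c + F1 c * (((b - c)\<^sup>2 - (a - c)\<^sup>2) / 2))) (cbox a b)"
    by (auto intro: has_integral_diff)
  then have "norm (integral {a..b} F - ((b - a) * F c + F1 c * (((b - c)\<^sup>2 - (a - c)\<^sup>2) / 2)))
      \<le> M * \<delta>\<^sup>2 * measure lborel (cbox a b)"
    by (rule has_integral_bound_spike_finite[rotated 2, where S = "{0}"])
      (use taylor ab near \<open>0 \<le> M\<close> in auto)
  then show ?thesis using ab by simp
qed

text \<open>
  At the midpoint of a panel the linear Taylor term integrates to zero by symmetry. On the remaining half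
  panel of length \<open>\<delta>\<close> next to \<open>l\<close> both the constant and the linear term at \<open>l\<close> vanish by the
  assumptions on \<open>F l\<close> and \<open>F1 l\<close>, so its whole integral is already of the order of the error. The error
  per unit of length is \<open>M \<delta>\<^sup>2\<close> everywhere.
\<close>

lemma midpoint_rule_error:
  fixes F F1 F2 :: "real \<Rightarrow> real" and K :: nat
  assumes "\<delta> > 0" and l: "l = (2 * real K + 1) * \<delta>"
    and F: "\<And>y. y \<in> {0<..l} \<Longrightarrow> (F has_real_derivative F1 y) (at y)"
    and F1: "\<And>y. y \<in> {0<..l} \<Longrightarrow> (F1 has_real_derivative F2 y) (at y)"
    and F2: "\<And>y. y \<in> {0<..l} \<Longrightarrow> \<bar>F2 y\<bar> \<le> M"
    and int: "F integrable_on {0..l}"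
    and end_zero: "F l = 0" "F1 l = 0"
  shows "\<bar>integral {0..l} F - 2 * \<delta> * (\<Sum>i<K. F ((2 * real i + 1) * \<delta>))\<bar> \<le> M * l * \<delta>\<^sup>2"
proof -
  note tangent = integral_tangent_error[OF F F1 F2 int]
  have panels: "\<bar>integral {0..2 * real n * \<delta>} F - 2 * \<delta> * (\<Sum>i<n. F ((2 * real i + 1) * \<delta>))\<bar>
      \<le> M * (2 * real n * \<delta>) * \<delta>\<^sup>2" if "n \<le> K" for n
    using that
  proof (induction n)
    case (Suc n)
    let ?a = "2 * real n * \<delta>" and ?b = "2 * real (Suc n) * \<delta>" and ?c = "(2 * real n + 1) * \<delta>"
    have "?b \<le> l" using Suc.prems \<open>\<delta> > 0\<close> by (auto simp: l intro!: mult_right_mono)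
    moreover have "?c < ?b" "0 < ?c" "?a = ?c - \<delta>" "?b = ?c + \<delta>"
      using \<open>\<delta> > 0\<close> by (auto simp: algebra_simps add_pos_nonneg)
    ultimately have *: "\<bar>integral {?a..?b} F - 2 * \<delta> * F ?c\<bar> \<le> M * \<delta>\<^sup>2 * (2 * \<delta>)"
      using tangent[of ?a ?b ?c \<delta>] \<open>\<delta> > 0\<close> by (simp add: algebra_simps)
    have "integral {0..?a} F + integral {?a..?b} F = integral {0..?b} F"
      using \<open>?b \<le> l\<close> \<open>\<delta> > 0\<close>
      by (intro Henstock_Kurzweil_Integration.integral_combine integrable_subinterval_real[OF int]) auto
    with * Suc.IH Suc.prems show ?case by (simp add: algebra_simps)
  qed auto
  have "\<bar>integral {2 * real K * \<delta>..l} F\<bar> \<le> M * \<delta>\<^sup>2 * \<delta>"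
  proof -
    have "l - 2 * real K * \<delta> = \<delta>" by (simp add: l algebra_simps)
    moreover have "0 < l" using \<open>\<delta> > 0\<close> by (simp add: l add_nonneg_pos)
    ultimately show ?thesis
      using tangent[of "2 * real K * \<delta>" l l \<delta>] \<open>\<delta> > 0\<close> end_zero by simp
  qed
  moreover have "integral {0..2 * real K * \<delta>} F + integral {2 * real K * \<delta>..l} F = integral {0..l} F"
    using \<open>\<delta> > 0\<close> by (intro Henstock_Kurzweil_Integration.integral_combine int) (auto simp: l algebra_simps)
  ultimately have "\<bar>integral {0..l} F - 2 * \<delta> * (\<Sum>i<K. F ((2 * real i + 1) * \<delta>))\<bar>
      \<le> M * (2 * real K * \<delta>) * \<delta>\<^sup>2 + M * \<delta>\<^sup>2 * \<delta>"
    using panels[of K] by linarith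
  also have "\<dots> = M * l * \<delta>\<^sup>2" by (simp add: l algebra_simps)
  finally show ?thesis .
qed

section \<open>The principal value as an integral of the folded integrand\<close>

lemma bounded_continuous_integrable_half_open:
  fixes F :: "real \<Rightarrow> real"
  assumes cont: "continuous_on {a<..b} F" and bound: "\<And>y. y \<in> {a<..b} \<Longrightarrow> \<bar>F y\<bar> \<le> M"
  shows "F integrable_on {a..b}"
proof -
  have "negligible (sym_diff {a<..b} {a..b})"
    by (rule negligible_subset[of "{a}"]) auto
  then have eq: "f integrable_on {a<..b} \<longleftrightarrow> f integrable_on {a..b}" for f :: "real \<Rightarrow> real"
    by (rule integrable_spike_set_eq)
  have "F integrable_on {a<..b}"
  proof (rule measurable_bounded_by_integrable_imp_integrable_real)
    show "F \<in> borel_measurable (lebesgue_on {a<..b})"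
      using cont by (rule continuous_imp_measurable_on_sets_lebesgue) auto
    show "(\<lambda>y. M) integrable_on {a<..b}" by (simp only: eq integrable_const_ivl)
  qed (use bound in auto)
  then show ?thesis by (simp add: eq)
qed

text \<open>
  The Hilbert integrand on the circle of length \<open>2 l\<close>, folded at its singular point. The principal value
  becomes an ordinary integral because the difference of \<open>u\<close> cancels the pole. At \<open>y = 0\<close> the formula
  gives \<open>0\<close>, in general not the limit there, so the integrand is treated on half-open intervals.
\<close>

definition folded_integrand :: "real \<Rightarrow> (real \<Rightarrow> real) \<Rightarrow> real \<Rightarrow> real \<Rightarrow> real" where
  "folded_integrand l u x y = cot (pi / (2 * l) * y) * (u (x - y) - u (x + y))"

lemma cot_double_eq: "cot (2 * t) = (cot t - tan t) / 2" if "sin t \<noteq> 0" "cos t \<noteq> 0" for t :: real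
  using that by (simp add: cot_def tan_def sin_double cos_double divide_simps power2_eq_square)

text \<open>
  Split the kernel by the double-angle formula and substitute \<open>y \<mapsto> l - y\<close> in the tangent part: the tangent
  turns into the cotangent and, by periodicity, \<open>u (x - y)\<close> into \<open>u (x + y)\<close>. The truncation is symmetric
  under this substitution, which is the point of the principal value.
\<close>

lemma truncated_hilbert_integral:
  assumes "l > 0" and period: "\<And>t. u (t + l) = u t" and cont: "continuous_on UNIV u"
    and "0 < \<epsilon>" "\<epsilon> < l / 2"
  shows "integral {\<epsilon>..l - \<epsilon>} (\<lambda>y. cot (pi / l * y) * u (x - y))
    = 1 / 2 * integral {\<epsilon>..l - \<epsilon>} (folded_integrand l u x)"
proof -
  let ?I = "{\<epsilon>..l - \<epsilon>}" and ?a = "pi / (2 * l)"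
  have range: "0 < ?a * y" "?a * y < pi / 2" if "y \<in> ?I" for y
    using that \<open>0 < l\<close> \<open>0 < \<epsilon>\<close> by (auto simp: field_simps)
  have pos: "sin (?a * y) > 0" "cos (?a * y) > 0" if "y \<in> ?I" for y
    using range[OF that] by (auto intro!: sin_gt_zero cos_gt_zero)
  have comp: "continuous_on S (\<lambda>y. u (f y))" if "continuous_on S f" for S and f :: "real \<Rightarrow> real"
    using cont that by (rule continuous_on_compose2) auto
  let ?A = "\<lambda>y. cot (?a * y) * u (x - y)" and ?B = "\<lambda>y. tan (?a * y) * u (x - y)"
    and ?C = "\<lambda>y. cot (?a * y) * u (x + y)"
  have A: "?A integrable_on ?I" and B: "?B integrable_on ?I" and C: "?C integrable_on ?I"
    using pos
    by (intro integrable_continuous_interval continuous_intros comp ballI; simp add: less_imp_neq[symmetric])+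
  \<comment> \<open>The reflection \<open>y \<mapsto> l - y\<close> as a shift followed by a sign change.\<close>
  have "integral ?I ?B = integral ?I (\<lambda>y. ?B (l - y))"
  proof -
    have "integral ?I ?B = integral {\<epsilon> - l..(l - \<epsilon>) - l} (\<lambda>y. ?B (y + l))"
      by (rule integral_shift_real_ivl[symmetric])
    also have "\<dots> = integral {- (l - \<epsilon>)..- \<epsilon>} (\<lambda>y. (\<lambda>z. ?B (l - z)) (- y))"
      by (simp add: add.commute)
    also have "\<dots> = integral ?I (\<lambda>y. ?B (l - y))"
      using Henstock_Kurzweil_Integration.integral_reflect_real[where f = "\<lambda>z. ?B (l - z)"] .
    finally show ?thesis .
  qed
  also have "(\<lambda>y. ?B (l - y)) = ?C"
  proof
    fix y
    have "?a * (l - y) = pi / 2 - ?a * y" using \<open>l > 0\<close> by (simp add: field_simps)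
    moreover have "u (x - (l - y)) = u (x + y)" using period[of "x - (l - y)"] by (simp add: algebra_simps)
    ultimately show "?B (l - y) = ?C y" by (simp add: tan_cot')
  qed
  finally have BC: "integral ?I ?B = integral ?I ?C" .
  have "integral ?I (\<lambda>y. cot (pi / l * y) * u (x - y)) = integral ?I (\<lambda>y. 1 / 2 * (?A y - ?B y))"
  proof (rule integral_cong)
    fix y assume "y \<in> ?I"
    have "cot (pi / l * y) = cot (2 * (?a * y))" by simp
    also have "\<dots> = (cot (?a * y) - tan (?a * y)) / 2"
      using pos[OF \<open>y \<in> ?I\<close>] by (intro cot_double_eq) auto
    finally show "cot (pi / l * y) * u (x - y) = 1 / 2 * (?A y - ?B y)" 
      by (simp only:) (simp add: algebra_simps diff_divide_distrib)
  qed
  also have "\<dots> = 1 / 2 * (integral ?I ?A - integral ?I ?B)"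
    using A B by (simp only: integral_mult_right integral_diff)
  also have "\<dots> = 1 / 2 * integral ?I (\<lambda>y. ?A y - ?C y)"
    using A C by (simp only: BC integral_diff)
  also have "(\<lambda>y. ?A y - ?C y) = folded_integrand l u x"
    by (auto simp: folded_integrand_def algebra_simps)
  finally show ?thesis .
qed

lemma periodic_hilbert_eq_integral:
  assumes "l > 0" and period: "\<And>t. u (t + l) = u t" and cont: "continuous_on UNIV u"
    and int: "folded_integrand l u x integrable_on {0..l}"
  shows "periodic_hilbert l u x = 1 / (2 * l) * integral {0..l} (folded_integrand l u x)"
proof -
  let ?F = "folded_integrand l u x"
  let ?P = "\<lambda>r. integral {0..r} ?F"
  have cP: "continuous_on {0..l} ?P" using int by (rule indefinite_integral_continuous_1)
  have ev: "\<forall>\<^sub>F \<epsilon> in at_right 0. 0 < \<epsilon> \<and> \<epsilon> < l / 2"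
    using \<open>l > 0\<close> by (auto simp: eventually_at_right_field intro!: exI[of _ "l/2"])
  have "((\<lambda>\<epsilon>. ?P (l - \<epsilon>)) \<longlongrightarrow> ?P (l - 0)) (at_right 0)"
  proof (rule continuous_on_tendsto_compose[OF cP])
    show "((\<lambda>\<epsilon>. l - \<epsilon>) \<longlongrightarrow> l - 0) (at_right 0)" by (intro tendsto_intros)
    show "\<forall>\<^sub>F \<epsilon> in at_right 0. l - \<epsilon> \<in> {0..l}" using ev by eventually_elim auto
  qed (use \<open>l > 0\<close> in auto)
  moreover have "(?P \<longlongrightarrow> ?P 0) (at_right 0)"
  proof (rule continuous_on_tendsto_compose[OF cP])
    show "\<forall>\<^sub>F \<epsilon> in at_right 0. \<epsilon> \<in> {0..l}" using ev by eventually_elim auto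
  qed (use \<open>l > 0\<close> in \<open>auto intro: tendsto_ident_at\<close>)
  ultimately have "((\<lambda>\<epsilon>. 1 / 2 * (?P (l - \<epsilon>) - ?P \<epsilon>)) \<longlongrightarrow> 1 / 2 * (?P (l - 0) - ?P 0)) (at_right 0)"
    by (intro tendsto_intros)
  moreover have "\<forall>\<^sub>F \<epsilon> in at_right 0. 1 / 2 * (?P (l - \<epsilon>) - ?P \<epsilon>)
      = integral {\<epsilon>..l - \<epsilon>} (\<lambda>y. cot (pi / l * y) * u (x - y))"
    using ev
  proof eventually_elim
    case (elim \<epsilon>)
    have "?P \<epsilon> + integral {\<epsilon>..l - \<epsilon>} ?F = ?P (l - \<epsilon>)"
      using elim by (intro Henstock_Kurzweil_Integration.integral_combine integrable_subinterval_real[OF int]) auto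
    then show ?case
      using truncated_hilbert_integral[OF \<open>l > 0\<close> period cont, of \<epsilon> x] elim by simp
  qed
  ultimately have "((\<lambda>\<epsilon>. integral {\<epsilon>..l - \<epsilon>} (\<lambda>y. cot (pi / l * y) * u (x - y)))
      \<longlongrightarrow> 1 / 2 * ?P l) (at_right 0)"
    by (auto intro: Lim_transform_eventually)
  then have "Lim (at_right 0) (\<lambda>\<epsilon>. integral {\<epsilon>..l - \<epsilon>} (\<lambda>y. cot (pi / l * y) * u (x - y)))
      = 1 / 2 * ?P l"
    by (rule tendsto_Lim[rotated]) simp
  then show ?thesis by (simp only: periodic_hilbert_def) simp
qed

section \<open>The discrete transform as a sum over odd nodes\<close>

lemma periodic_add_int_multiple:
  fixes f :: "'a::ring_1 \<Rightarrow> 'b"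
  assumes period: "\<And>t. f (t + p) = f t"
  shows "f (t + of_int k * p) = f t"
proof (induction k rule: int_induct[where k = 0])
  case (step1 i)
  then show ?case using period[of "t + of_int i * p"] by (simp add: algebra_simps)
next
  case (step2 i)
  then show ?case using period[of "t + of_int (i - 1) * p"] by (simp add: algebra_simps)
qed simp

text \<open>
  Adding the odd number \<open>N\<close> switches the parity of \<open>m\<close> and moves the angle by \<open>\<pi> / 2\<close>; the two branches
  of the kernel are arranged so that these changes compensate.
\<close>

lemma hilbert_kernel_periodic:
  assumes "odd N"
  shows "hilbert_kernel N (m + int N) = hilbert_kernel N m"
proof -
  have "N > 0" using assms by (rule odd_pos)
  let ?t = "pi * of_int m / (2 * real N)"
  have "pi * of_int (m + int N) / (2 * real N) = ?t + pi / 2"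
    using \<open>N > 0\<close> by (simp add: field_simps)
  moreover have "cot (?t + pi / 2) = - tan ?t" "tan (?t + pi / 2) = - cot ?t"
    by (simp_all add: cot_def tan_def sin_add cos_add)
  ultimately show ?thesis using assms by (simp add: hilbert_kernel_def)
qed

lemma hilbert_kernel_minus: "hilbert_kernel N (- m) = - hilbert_kernel N m"
  by (simp add: hilbert_kernel_def cot_minus)

text \<open>
  Since \<open>2\<close> is invertible modulo the odd number \<open>2 K + 1\<close>, the odd numbers \<open>2 i + 1\<close> with \<open>-K \<le> i \<le> K\<close>
  form a complete residue system.
\<close>

lemma sum_periodic_over_step_two:
  fixes f :: "int \<Rightarrow> real"
  assumes period: "\<And>j. f (j + int (2 * K + 1)) = f j"
  shows "(\<Sum>j = 0..<int (2 * K + 1). f j) = (\<Sum>i = - int K..int K. f (n - (2 * i + 1)))"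
proof -
  let ?N = "int (2 * K + 1)"
  let ?\<sigma> = "\<lambda>i. (n - (2 * i + 1)) mod ?N"
  have f_mod: "f (j mod ?N) = f j" for j
    using periodic_add_int_multiple[of f ?N "j mod ?N" "j div ?N", OF period]
    by (simp add: mod_div_mult_eq del: of_nat_add of_nat_mult)
  have inj: "inj_on ?\<sigma> {- int K..int K}"
  proof (rule inj_onI)
    fix i j assume ij: "i \<in> {- int K..int K}" "j \<in> {- int K..int K}" "?\<sigma> i = ?\<sigma> j"
    then have "?N dvd (n - (2 * i + 1)) - (n - (2 * j + 1))" by (simp only: mod_eq_dvd_iff)
    moreover have "(n - (2 * i + 1)) - (n - (2 * j + 1)) = 2 * (j - i)" by simp
    ultimately have "?N dvd 2 * (j - i)" by metis
    moreover have "coprime ?N 2" by simp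
    ultimately have "?N dvd j - i" by (simp only: coprime_dvd_mult_right_iff)
    moreover have "\<bar>j - i\<bar> < ?N" using ij by auto
    ultimately show "i = j" using zdvd_imp_le[of ?N "\<bar>j - i\<bar>"] by fastforce
  qed
  have "?\<sigma> ` {- int K..int K} = {0..<?N}"
    by (rule card_subset_eq) (use card_image[OF inj] in auto)
  with inj have "bij_betw ?\<sigma> {- int K..int K} {0..<?N}" by (simp add: bij_betw_def)
  then have "(\<Sum>j = 0..<?N. f j) = (\<Sum>i = - int K..int K. f (?\<sigma> i))"
    by (rule sum.reindex_bij_betw[symmetric])
  then show ?thesis by (simp only: f_mod)
qed

text \<open>
  The odd representatives of the residues select the cotangent branch. The largest one
  is \<open>N\<close> itself, the class of the singular point, and has weight \<open>cot (\<pi> / 2) = 0\<close>; the others pair up as \<open>\<plusminus>(2 i + 1)\<close> because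
  the kernel is odd.
\<close>

lemma discrete_hilbert_eq_odd_sum:
  assumes N: "N = 2 * K + 1" and period: "\<And>j. v (j + int N) = v j"
  shows "discrete_hilbert N v n =
    (\<Sum>i<K. 1 / real N * cot (pi * (2 * real i + 1) / (2 * real N))
        * (v (n - (2 * int i + 1)) - v (n + (2 * int i + 1))))"
proof -
  let ?d = "hilbert_kernel N"
  define g where "g i = ?d (2 * i + 1) * v (n - (2 * i + 1))" for i
  have "?d (n - (j + int N)) = ?d (n - j)" for j
    using hilbert_kernel_periodic[of N "n - (j + int N)"] N by (simp add: algebra_simps)
  then have "discrete_hilbert N v n = (\<Sum>i = - int K..int K. ?d (n - (n - (2 * i + 1))) * v (n - (2 * i + 1)))"
    unfolding discrete_hilbert_def N
    by (intro sum_periodic_over_step_two) (use period N in simp)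
  also have "\<dots> = (\<Sum>i = - int K..int K. g i)" by (simp add: g_def)
  also have "{- int K..int K} = insert (int K) ((\<lambda>i. - 1 - int i) ` {..<K} \<union> int ` {..<K})"
    (is "?L = ?R")
  proof
    show "?L \<subseteq> ?R"
    proof
      fix i assume i: "i \<in> ?L"
      consider "i = int K" | "i < 0" | "0 \<le> i" "i < int K" using i by fastforce
      then show "i \<in> ?R"
      proof cases
        case 2
        then have "i = - 1 - int (nat (- 1 - i))" "nat (- 1 - i) < K" using i by auto
        then show ?thesis by blast
      next
        case 3
        then have "i = int (nat i)" "nat i < K" by auto
        then show ?thesis by blast
      qed simp
    qed
  qed auto
  also have "sum g \<dots> = g (int K) + (sum g ((\<lambda>i. - 1 - int i) ` {..<K}) + sum g (int ` {..<K}))"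
    by (subst sum.insert; (subst sum.union_disjoint)?) auto
  also have "g (int K) = 0"
  proof -
    have "of_int (2 * int K + 1) = real N" "odd (2 * int K + 1)" by (simp_all add: N)
    then have "?d (2 * int K + 1) = 1 / real N * cot (pi * real N / (2 * real N))"
      by (simp only: hilbert_kernel_def if_True not_False_eq_True)
    also have "pi * real N / (2 * real N) = pi / 2"
    proof -
      have "real N \<noteq> 0" by (simp add: N)
      then show ?thesis by simp
    qed
    also have "1 / real N * cot (pi / 2) = 0" by (simp add: cot_def)
    finally show ?thesis by (simp add: g_def)
  qed
  also have "sum g ((\<lambda>i. - 1 - int i) ` {..<K}) = (\<Sum>i<K. g (- 1 - int i))"
    by (subst sum.reindex) (auto simp: inj_on_def)
  also have "sum g (int ` {..<K}) = (\<Sum>i<K. g (int i))"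
    by (subst sum.reindex) auto
  also have "0 + ((\<Sum>i<K. g (- 1 - int i)) + (\<Sum>i<K. g (int i)))
      = (\<Sum>i<K. ?d (2 * int i + 1) * (v (n - (2 * int i + 1)) - v (n + (2 * int i + 1))))"
  proof -
    have "g (- 1 - int i) + g (int i)
        = ?d (2 * int i + 1) * (v (n - (2 * int i + 1)) - v (n + (2 * int i + 1)))" for i
    proof -
      have "2 * (- 1 - int i) + 1 = - (2 * int i + 1)" by simp
      then show ?thesis
        unfolding g_def by (simp only: hilbert_kernel_minus) (simp add: algebra_simps)
    qed
    then show ?thesis by (simp flip: sum.distrib)
  qed
  also have "\<dots> = (\<Sum>i<K. 1 / real N * cot (pi * (2 * real i + 1) / (2 * real N))
        * (v (n - (2 * int i + 1)) - v (n + (2 * int i + 1))))"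
    by (simp add: hilbert_kernel_def)
  finally show ?thesis .
qed

section \<open>Periodic functions with three continuous derivatives\<close>

lemma C_diff_has_derivative:
  assumes "C_diff k u" and "i < k"
  shows "((deriv ^^ i) u has_real_derivative (deriv ^^ Suc i) u x) (at x)"
  using assms by (simp add: C_diff_def DERIV_deriv_iff_field_differentiable)

lemma C_diff_continuous:
  assumes "C_diff k u" and "i \<le> k"
  shows "continuous_on UNIV ((deriv ^^ i) u)"
proof (cases "i = k")
  case False
  then show ?thesis
    using C_diff_has_derivative[OF assms(1), of i] assms(2)
    by (intro continuous_at_imp_continuous_on ballI) (meson DERIV_isCont le_neq_implies_less)
qed (use assms in \<open>simp add: C_diff_def\<close>)

lemma iterated_deriv_periodic:
  fixes u :: "real \<Rightarrow> real"
  assumes "\<And>t. u (t + l) = u t"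
  shows "(deriv ^^ i) u (t + l) = (deriv ^^ i) u t"
proof (induction i arbitrary: t)
  case (Suc i)
  let ?f = "(deriv ^^ i) u"
  have "(?f has_real_derivative D) (at (t + l)) \<longleftrightarrow> (?f has_real_derivative D) (at t)" for D
    by (simp add: DERIV_shift Suc.IH)
  then show ?case by (simp add: deriv_def[of ?f])
qed (use assms in simp)

lemma periodic_continuous_bdd_above:
  fixes f :: "real \<Rightarrow> real"
  assumes "l > 0" and period: "\<And>t. f (t + l) = f t" and cont: "continuous_on UNIV f"
  shows "bdd_above (range (\<lambda>x. \<bar>f x\<bar>))"
proof -
  have "compact (f ` {0..l})"
    using cont by (intro compact_continuous_image continuous_on_subset[OF cont]) auto
  then have "bounded (f ` {0..l})" by (rule compact_imp_bounded)
  then obtain B where B: "\<And>x. x \<in> {0..l} \<Longrightarrow> \<bar>f x\<bar> \<le> B"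
    unfolding bounded_iff by (metis imageI real_norm_def)
  show ?thesis
  proof (rule bdd_aboveI2)
    fix x :: real
    let ?y = "x + of_int (- \<lfloor>x / l\<rfloor>) * l"
    have "of_int \<lfloor>x / l\<rfloor> * l \<le> x" "x < (of_int \<lfloor>x / l\<rfloor> + 1) * l"
      using \<open>l > 0\<close> by (rule floor_divide_lower, rule floor_divide_upper)
    then have "?y \<in> {0..l}" by (auto simp: algebra_simps)
    then have "\<bar>f ?y\<bar> \<le> B" by (rule B)
    also have "f ?y = f x" using period by (rule periodic_add_int_multiple)
    finally show "\<bar>f x\<bar> \<le> B" .
  qed
qed

text \<open>
  Every derivative of \<open>u\<close> is periodic and continuous, hence bounded, so that the suprema in the norm are
  upper bounds; the supremum of an unbounded set of reals would be an unspecified value.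
\<close>

lemma abs_deriv_le_C3_norm:
  assumes "l > 0" and period: "\<And>t. u (t + l) = u t" and C3: "C_diff 3 u" and "i \<le> 3"
  shows "\<bar>(deriv ^^ i) u x\<bar> \<le> C3_norm u"
proof -
  let ?s = "\<lambda>i. SUP x. \<bar>(deriv ^^ i) u x\<bar>"
  have le_sup: "\<bar>(deriv ^^ j) u x\<bar> \<le> ?s j" if "j \<le> 3" for j x
    using \<open>l > 0\<close> period C3 that
    by (intro cSUP_upper periodic_continuous_bdd_above[where l = l] iterated_deriv_periodic
        C_diff_continuous[OF C3]) auto
  have "\<bar>(deriv ^^ i) u x\<bar> \<le> ?s i" using le_sup[OF \<open>i \<le> 3\<close>] .
  also have "\<dots> \<le> (\<Sum>i\<le>3. ?s i)"
    using \<open>i \<le> 3\<close> order_trans[OF abs_ge_zero le_sup] by (intro member_le_sum) auto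
  finally show ?thesis by (simp add: C3_norm_def)
qed

section \<open>Derivatives of the folded integrand\<close>

text \<open>
  On \<open>(0, l]\<close> the integrand is the product of \<open>g y = y cot (a y)\<close> and \<open>k y = h y / y\<close>, where
  \<open>h y = u (x - y) - u (x + y)\<close>, and every factor in the product rule is bounded. The double zero at \<open>l\<close>
  comes from \<open>cot (\<pi> / 2) = 0\<close> and, by periodicity, from \<open>h l = 0\<close>.
\<close>

lemma folded_integrand_derivatives:
  fixes u u1 u2 u3 :: "real \<Rightarrow> real" and l x B :: real
  defines "a \<equiv> pi / (2 * l)"
  assumes "l > 0" and "B \<ge> 0" and period: "\<And>t. u (t + l) = u t"
    and u1: "\<And>t. (u has_real_derivative u1 t) (at t)"
    and u2: "\<And>t. (u1 has_real_derivative u2 t) (at t)"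
    and u3: "\<And>t. (u2 has_real_derivative u3 t) (at t)"
    and b: "\<And>t. \<bar>u1 t\<bar> \<le> B" "\<And>t. \<bar>u2 t\<bar> \<le> B" "\<And>t. \<bar>u3 t\<bar> \<le> B"
  obtains F1 F2 where
    "\<And>y. y \<in> {0<..l} \<Longrightarrow> (folded_integrand l u x has_real_derivative F1 y) (at y)"
    "\<And>y. y \<in> {0<..l} \<Longrightarrow> (F1 has_real_derivative F2 y) (at y)"
    "\<And>y. y \<in> {0<..l} \<Longrightarrow> \<bar>folded_integrand l u x y\<bar> \<le> 4 / a * B"
    "\<And>y. y \<in> {0<..l} \<Longrightarrow> \<bar>F2 y\<bar> \<le> (32 * a + 64 + 4 / a) * B"
    "folded_integrand l u x l = 0" "F1 l = 0"
proof
  have "a > 0" using \<open>l > 0\<close> by (simp add: a_def)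
  define h where "h y = u (x - y) - u (x + y)" for y
  define h1 where "h1 y = - u1 (x - y) - u1 (x + y)" for y
  define h2 where "h2 y = u2 (x - y) - u2 (x + y)" for y
  define h3 where "h3 y = - u3 (x - y) - u3 (x + y)" for y
  define k where "k y = h y / y" for y
  define k1 where "k1 y = (y * h1 y - h y) / y ^ 2" for y
  define k2 where "k2 y = (y\<^sup>2 * h2 y - 2 * y * h1 y + 2 * h y) / y ^ 3" for y
  define g where "g y = 1 / a * xcot (a * y)" for y
  define g1 where "g1 y = xcot1 (a * y)" for y
  define g2 where "g2 y = a * xcot2 (a * y)" for y
  let ?F = "folded_integrand l u x"
  \<comment> \<open>Product rule, in the form in which \<open>DERIV_mult\<close> delivers it.\<close>
  let ?F1 = "\<lambda>y. g1 y * k y + k1 y * g y"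
  let ?F2 = "\<lambda>y. (g2 y * k y + k1 y * g1 y) + (k2 y * g y + g1 y * k1 y)"

  have chain: "((\<lambda>y. f (x - y)) has_real_derivative - f' (x - y)) (at y)"
      "((\<lambda>y. f (x + y)) has_real_derivative f' (x + y)) (at y)"
    if "\<And>t. (f has_real_derivative f' t) (at t)" for f f' :: "real \<Rightarrow> real" and y
    by (rule DERIV_chain2[OF that, THEN DERIV_cong]
        | (rule derivative_eq_intros refl)+ | simp)+
  have h: "(h has_real_derivative h1 y) (at y)" "(h1 has_real_derivative h2 y) (at y)"
      "(h2 has_real_derivative h3 y) (at y)" for y
    unfolding h_def[abs_def] h1_def[abs_def] h2_def[abs_def] h3_def
    by (rule derivative_eq_intros chain u1 u2 u3 refl | simp)+
  have "\<bar>h1 y\<bar> \<le> 2 * B" "\<bar>h2 y\<bar> \<le> 2 * B" "\<bar>h3 y\<bar> \<le> 2 * B" for y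
    unfolding h1_def h2_def h3_def
    using b(1)[of "x - y"] b(1)[of "x + y"] b(2)[of "x - y"] b(2)[of "x + y"]
      b(3)[of "x - y"] b(3)[of "x + y"] by linarith+
  note divided_difference_bounds[where B = "2 * B", OF _ _ _ h this]
  then have k_bound: "\<bar>k y\<bar> \<le> 2 * B" "\<bar>k1 y\<bar> \<le> 2 * B" "\<bar>k2 y\<bar> \<le> 2 * B" if "y > 0" for y
    using that \<open>B \<ge> 0\<close> by (simp_all add: k_def k1_def k2_def h_def)
  have k: "(k has_real_derivative k1 y) (at y)" "(k1 has_real_derivative k2 y) (at y)" if "y > 0" for y
    using divided_difference_derivatives[of y h h1 h2, OF _ h(1,2)] that
    by (simp_all add: k_def[abs_def] k1_def[abs_def] k2_def)

  have range: "0 < a * y" "a * y \<le> pi / 2" if "y \<in> {0<..l}" for y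
    using that \<open>l > 0\<close> by (auto simp: a_def field_simps)
  have sin_ne: "sin (a * y) \<noteq> 0" if "y \<in> {0<..l}" for y
    using range[OF that] by (intro less_imp_neq[symmetric] sin_gt_zero) auto
  have g: "(g has_real_derivative g1 y) (at y)" "(g1 has_real_derivative g2 y) (at y)"
    if "y \<in> {0<..l}" for y
  proof -
    have lin: "((\<lambda>y. a * y) has_real_derivative a) (at y)"
      by (rule derivative_eq_intros refl | simp)+
    show "(g has_real_derivative g1 y) (at y)"
      using DERIV_cmult[OF DERIV_chain2[OF has_derivative_xcot[OF sin_ne[OF that]] lin], of "1 / a"] \<open>a > 0\<close>
      by (simp add: g_def[abs_def] g1_def)
    show "(g1 has_real_derivative g2 y) (at y)"
      using DERIV_chain2[OF has_derivative_xcot1[OF sin_ne[OF that]] lin]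
      by (simp add: g1_def[abs_def] g2_def mult.commute)
  qed
  have g_bound: "\<bar>g y\<bar> \<le> 2 / a" "\<bar>g1 y\<bar> \<le> 16" "\<bar>g2 y\<bar> \<le> 16 * a" if "y \<in> {0<..l}" for y
    using xcot_bounds[OF range[OF that]] \<open>a > 0\<close>
    by (simp_all add: g_def g1_def g2_def abs_mult divide_right_mono mult.commute[of a] mult_right_mono)
  have F_eq: "?F y = g y * k y" if "y \<noteq> 0" for y
    using that \<open>a > 0\<close> by (simp add: folded_integrand_def g_def k_def h_def xcot_def a_def)

  show "(?F has_real_derivative ?F1 y) (at y)" if "y \<in> {0<..l}" for y
  proof (rule has_field_derivative_transform_within_open[where S = "{0<..}"])
    show "((\<lambda>y. g y * k y) has_real_derivative ?F1 y) (at y)"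
      using g(1)[OF that] k(1)[of y] that by (intro DERIV_mult) auto
  qed (use that F_eq in auto)
  show "(?F1 has_real_derivative ?F2 y) (at y)" if "y \<in> {0<..l}" for y
    using g[OF that] k[of y] that by (intro DERIV_add DERIV_mult) auto
  have mult_bound: "\<bar>p * q\<bar> \<le> P * Q" if "\<bar>p\<bar> \<le> P" "\<bar>q\<bar> \<le> Q" for p q P Q :: real
    using that by (simp add: abs_mult mult_mono')
  show "\<bar>?F y\<bar> \<le> 4 / a * B" if "y \<in> {0<..l}" for y
    using mult_bound[OF g_bound(1)[OF that] k_bound(1)[of y]] that by (simp add: F_eq)
  show "\<bar>?F2 y\<bar> \<le> (32 * a + 64 + 4 / a) * B" if "y \<in> {0<..l}" for y
  proof -
    have "y > 0" using that by simp
    note gb = g_bound[OF that] and kb = k_bound[OF this]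
    have "\<bar>?F2 y\<bar> \<le> (16 * a * (2 * B) + 2 * B * 16) + (2 * B * (2 / a) + 16 * (2 * B))"
      by (intro order_trans[OF abs_triangle_ineq] add_mono mult_bound gb kb)
    then show ?thesis by (simp add: algebra_simps)
  qed
  have "h l = 0"
    using period[of "x - l"] period[of x] by (simp add: h_def)
  then have "k l = 0" by (simp add: k_def)
  moreover have "g l = 0"
    using \<open>l > 0\<close> by (simp add: g_def xcot_def cot_def a_def)
  ultimately show "?F l = 0" "?F1 l = 0"
    using \<open>l > 0\<close> by (simp_all add: F_eq)
qed

section \<open>Second-order accuracy\<close>

text \<open>
  The discrete and the continuous transform are the midpoint rule and the integral for the same folded
  integrand, so their difference is a quadrature error. The panels have width \<open>2 \<delta>\<close>, and
  \<open>2 \<delta> / (2 l) = 1 / N\<close> matches the weights.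
\<close>

lemma discrete_hilbert_error:
  assumes "l > 0" and "odd N" and C3: "C_diff 3 u" and period: "\<And>t. u (t + l) = u t"
  defines "a \<equiv> pi / (2 * l)" and "\<delta> \<equiv> l / real N"
  shows "\<bar>discrete_hilbert N (\<lambda>m. u (of_int m * \<delta>)) n - periodic_hilbert l u (of_int n * \<delta>)\<bar>
    \<le> (32 * a + 64 + 4 / a) / 2 * \<delta>\<^sup>2 * C3_norm u"
proof -
  obtain K where N: "N = 2 * K + 1" using \<open>odd N\<close> by (rule oddE)
  have "\<delta> > 0" using \<open>l > 0\<close> by (simp add: \<delta>_def N)
  have l: "l = (2 * real K + 1) * \<delta>" and l': "l = real N * \<delta>"
    by (simp_all add: \<delta>_def N add.commute)
  let ?x = "of_int n * \<delta>" and ?B = "C3_norm u" and ?M = "(32 * a + 64 + 4 / a) * C3_norm u"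
  let ?F = "folded_integrand l u ?x"
  let ?D = "\<lambda>i. (deriv ^^ i) u"
  have D: "(u has_real_derivative ?D 1 t) (at t)" "(?D 1 has_real_derivative ?D 2 t) (at t)"
      "(?D 2 has_real_derivative ?D 3 t) (at t)" for t
    using C_diff_has_derivative[OF C3, of 0 t] C_diff_has_derivative[OF C3, of 1 t]
      C_diff_has_derivative[OF C3, of 2 t] by (simp_all add: numeral_2_eq_2 numeral_3_eq_3)
  have bound: "\<bar>?D i t\<bar> \<le> ?B" if "i \<le> 3" for i t
    using abs_deriv_le_C3_norm[OF \<open>l > 0\<close> period C3 that] .
  have "?B \<ge> 0" using order_trans[OF abs_ge_zero bound[of 0 0]] by simp
  \<comment> \<open>The second derivative controls the quadrature error; the bound on the integrand itself gives its integrability.\<close>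
  obtain F1 F2 where
    F: "\<And>y. y \<in> {0<..l} \<Longrightarrow> (?F has_real_derivative F1 y) (at y)"
       "\<And>y. y \<in> {0<..l} \<Longrightarrow> (F1 has_real_derivative F2 y) (at y)"
    and F_bound: "\<And>y. y \<in> {0<..l} \<Longrightarrow> \<bar>?F y\<bar> \<le> 4 / a * ?B"
    and F2_bound: "\<And>y. y \<in> {0<..l} \<Longrightarrow> \<bar>F2 y\<bar> \<le> ?M"
    and zero: "?F l = 0" "F1 l = 0"
    unfolding a_def
    by (rule folded_integrand_derivatives[where B = ?B and x = ?x, OF \<open>l > 0\<close> \<open>?B \<ge> 0\<close> period
        D bound bound bound]) auto
  have int: "?F integrable_on {0..l}"
  proof (rule bounded_continuous_integrable_half_open[OF _ F_bound])
    show "continuous_on {0<..l} ?F"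
      using F(1) by (intro continuous_at_imp_continuous_on ballI) (blast intro: DERIV_isCont)
  qed
  let ?S = "\<Sum>i<K. ?F ((2 * real i + 1) * \<delta>)"
  have "discrete_hilbert N (\<lambda>m. u (of_int m * \<delta>)) n =
    (\<Sum>i<K. 1 / real N * cot (pi * (2 * real i + 1) / (2 * real N))
        * (u (of_int (n - (2 * int i + 1)) * \<delta>) - u (of_int (n + (2 * int i + 1)) * \<delta>)))"
  proof (rule discrete_hilbert_eq_odd_sum[OF N])
    fix j
    have "of_int (j + int N) * \<delta> = of_int j * \<delta> + l" by (simp add: l' algebra_simps)
    then show "u (of_int (j + int N) * \<delta>) = u (of_int j * \<delta>)" by (simp only: period)
  qed
  also have "\<dots> = (\<Sum>i<K. 1 / real N * ?F ((2 * real i + 1) * \<delta>))"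
  proof (rule sum.cong[OF refl])
    fix i
    have "pi * (2 * real i + 1) / (2 * real N) = pi / (2 * l) * ((2 * real i + 1) * \<delta>)"
      using \<open>\<delta> > 0\<close> by (simp add: l' N)
    moreover have "of_int (n - (2 * int i + 1)) * \<delta> = ?x - (2 * real i + 1) * \<delta>"
      "of_int (n + (2 * int i + 1)) * \<delta> = ?x + (2 * real i + 1) * \<delta>"
      by (simp_all add: algebra_simps)
    ultimately show "1 / real N * cot (pi * (2 * real i + 1) / (2 * real N))
        * (u (of_int (n - (2 * int i + 1)) * \<delta>) - u (of_int (n + (2 * int i + 1)) * \<delta>))
      = 1 / real N * ?F ((2 * real i + 1) * \<delta>)"
      by (simp only: folded_integrand_def mult.assoc)
  qed
  also have "\<dots> = 1 / (2 * l) * (2 * \<delta> * ?S)"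
    using \<open>\<delta> > 0\<close> by (simp add: l' N sum_distrib_left)
  finally have "discrete_hilbert N (\<lambda>m. u (of_int m * \<delta>)) n - periodic_hilbert l u ?x
      = 1 / (2 * l) * (2 * \<delta> * ?S - integral {0..l} ?F)"
    using periodic_hilbert_eq_integral[OF \<open>l > 0\<close> period _ int] C_diff_continuous[OF C3, of 0]
    by (simp add: right_diff_distrib)
  then have "\<bar>discrete_hilbert N (\<lambda>m. u (of_int m * \<delta>)) n - periodic_hilbert l u ?x\<bar>
      = 1 / (2 * l) * \<bar>integral {0..l} ?F - 2 * \<delta> * ?S\<bar>"
    using \<open>l > 0\<close> by (simp add: abs_mult abs_minus_commute)
  also have "\<dots> \<le> 1 / (2 * l) * (?M * l * \<delta>\<^sup>2)"
    using midpoint_rule_error[OF \<open>\<delta> > 0\<close> l F F2_bound int zero] \<open>l > 0\<close>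
    by (intro mult_left_mono) auto
  also have "\<dots> = (32 * a + 64 + 4 / a) / 2 * \<delta>\<^sup>2 * ?B"
    using \<open>l > 0\<close> by simp
  finally show ?thesis .
qed

theorem lemma4:
  fixes l :: real
  assumes "l > 0"
  shows "\<exists>C::real. \<forall>(N::nat) (u :: real \<Rightarrow> real) (\<Delta>x::real) (x :: int \<Rightarrow> real).
           odd N \<longrightarrow> \<Delta>x = l / real N \<longrightarrow> (\<forall>n. x n = of_int n * \<Delta>x) \<longrightarrow>
           C_diff 3 u \<longrightarrow> (\<forall>t. u (t + l) = u t) \<longrightarrow>
           max_norm N (\<lambda>n. discrete_hilbert N (\<lambda>m. u (x m)) n - periodic_hilbert l u (x n))
             \<le> C * \<Delta>x\<^sup>2 * C3_norm u"
proof (intro exI allI impI)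
  let ?a = "pi / (2 * l)"
  fix N :: nat and u :: "real \<Rightarrow> real" and \<Delta>x :: real and x :: "int \<Rightarrow> real"
  assume *: "odd N" "\<Delta>x = l / real N" "\<forall>n. x n = of_int n * \<Delta>x" "C_diff 3 u" "\<forall>t. u (t + l) = u t"
  have "N > 0" using \<open>odd N\<close> by (rule odd_pos)
  have "\<bar>discrete_hilbert N (\<lambda>m. u (x m)) n - periodic_hilbert l u (x n)\<bar>
      \<le> (32 * ?a + 64 + 4 / ?a) / 2 * \<Delta>x\<^sup>2 * C3_norm u" for n
    using discrete_hilbert_error[OF \<open>l > 0\<close> *(1,4), of n] *(2,3,5) by simp
  then show "max_norm N (\<lambda>n. discrete_hilbert N (\<lambda>m. u (x m)) n - periodic_hilbert l u (x n))
      \<le> (32 * ?a + 64 + 4 / ?a) / 2 * \<Delta>x\<^sup>2 * C3_norm u"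
    unfolding max_norm_def using \<open>N > 0\<close> by (intro Max.boundedI) auto
qed

end
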